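(* Let $L$ be a domain and let $E$ be a topological space with Borel $\sigma$-algebra $\mathcal{B}$. Then every $L$-valued maxitive measure on $\mathcal{B}$ that is both weakly outer-continuous and weakly inner-continuous is regular and completely maxitive.
   Context: Order theory. $\bigoplus$ denotes supremum, $\bigwedge$ infimum; equations assert that these exist with the stated values. A filter in a poset $L$ is a nonempty upper set $F$ in which any two elements have a lower bound in $F$. $s\gg r$ means: for every filter $F$ having an infimum, $r\geqslant\bigwedge F$ implies $s\in F$. $L$ is continuous if for every $r\in L$ the set $\{s: s\gg r\}$ is a filter with infimum $r$. A domain is a continuous poset in which every filter has an infimum; every domain is assumed to have a bottom element $0$. Topology. $\mathcal{G}$ is the collection of open subsets of $E$. A subset is saturated if it is an intersection of open subsets; $\uparrow\! A$ is the intersection of all open subsets containing $A$. Compact does not require Hausdorff. $\mathcal{B}$ is the $\sigma$-algebra generated by the open subsets and the compact saturated subsets. $\mathcal{K}$ is the collection of compact subsets belonging to $\mathcal{B}$. Maxitive measures. A map $\nu:\mathcal{B}\to L$ is a maxitive measure (resp. completely maxitive) if $\nu(\emptyset)=0$ and for every finite (resp. arbitrary) family $(B_j)_{j\in J}$ in $\mathcal{B}$ with $\bigcup_j B_j\in\mathcal{B}$, the supremum of the $\nu(B_j)$ exists and equals $\nu(\bigcup_j B_j)$. $\nu^{+}(B):=\bigwedge_{G\in\mathcal{G},G\supset B}\nu(G)$ for $B\in\mathcal{B}$. $\nu$ is weakly inner-continuous if $\nu(G)=\bigoplus_{K\in\mathcal{K},K\subset G}\nu^{+}(K)$ for all $G\in\mathcal{G}$;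 weakly outer-continuous if $\nu(K)=\nu^{+}(K)$ for all $K\in\mathcal{K}$; regular if for all $B\in\mathcal{B}$ both $\nu(B)=\bigoplus_{K\in\mathcal{K},K\subset B}\nu(\uparrow\! K)$ and $\nu(B)=\nu^{+}(B)$. *)

theory Defs
  imports "HOL-Analysis.Analysis" "HOL-Library.Lub_Glb"
begin

text \<open>
  The value poset \<open>L\<close> is a type of class \<^class>\<open>order_bot\<close>. Suprema and infima need not exist,
  so an equation asserting that \<open>x\<close> is the supremum (infimum) of \<open>S\<close> is rendered as
  \<open>isLub UNIV S x\<close> (\<open>isGlb UNIV S x\<close>), which includes the existence claim.
\<close>

section \<open>Domains\<close>

definition poset_filter :: "'l::order set \<Rightarrow> bool" where
  "poset_filter F \<longleftrightarrow>
     F \<noteq> {} \<and>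
     (\<forall>x\<in>F. \<forall>y. x \<le> y \<longrightarrow> y \<in> F) \<and>
     (\<forall>x\<in>F. \<forall>y\<in>F. \<exists>z\<in>F. z \<le> x \<and> z \<le> y)"

definition way_above :: "'l::order \<Rightarrow> 'l \<Rightarrow> bool" where
  "way_above s r \<longleftrightarrow>
     (\<forall>F i. poset_filter F \<and> isGlb UNIV F i \<and> i \<le> r \<longrightarrow> s \<in> F)"

text \<open>Since these are properties of a type, the type is passed through \<^typ>\<open>'l itself\<close>.\<close>

definition continuous_poset :: "'l::order itself \<Rightarrow> bool" where
  "continuous_poset _ \<longleftrightarrow>
     (\<forall>r::'l. poset_filter {s. way_above s r} \<and> isGlb UNIV {s. way_above s r} r)"

definition is_domain :: "'l::order_bot itself \<Rightarrow> bool" where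
  "is_domain L \<longleftrightarrow>
     continuous_poset L \<and> (\<forall>F::'l set. poset_filter F \<longrightarrow> (\<exists>i. isGlb UNIV F i))"

section \<open>Saturated sets and the Borel sigma-algebra\<close>

text \<open>The intersection with \<^term>\<open>topspace E\<close> only matters for the empty family.\<close>

definition saturated_in :: "'e topology \<Rightarrow> 'e set \<Rightarrow> bool" where
  "saturated_in E A \<longleftrightarrow>
     (\<exists>\<U>. (\<forall>U\<in>\<U>. openin E U) \<and> A = topspace E \<inter> \<Inter>\<U>)"

definition saturation :: "'e topology \<Rightarrow> 'e set \<Rightarrow> 'e set" where
  "saturation E A = \<Inter>{U. openin E U \<and> A \<subseteq> U}"

definition borel_algebra :: "'e topology \<Rightarrow> 'e set set" where
  "borel_algebra E =
     sigma_sets (topspace E) ({U. openin E U} \<union> {K. compactin E K \<and> saturated_in E K})"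

definition compact_borel :: "'e topology \<Rightarrow> 'e set set" where
  "compact_borel E = {K. compactin E K \<and> K \<in> borel_algebra E}"

section \<open>Maxitive measures\<close>

text \<open>
  A map on \<^term>\<open>borel_algebra E\<close> is a total function whose values elsewhere are never used.
  Since a supremum only depends on the set of members, families are represented by sets of sets.
\<close>

definition maxitive_measure :: "'e topology \<Rightarrow> ('e set \<Rightarrow> 'l::order_bot) \<Rightarrow> bool" where
  "maxitive_measure E \<nu> \<longleftrightarrow>
     \<nu> {} = bot \<and>
     (\<forall>\<F>. finite \<F> \<and> \<F> \<subseteq> borel_algebra E \<and> \<Union>\<F> \<in> borel_algebra E
        \<longrightarrow> isLub UNIV (\<nu> ` \<F>) (\<nu> (\<Union>\<F>)))"

definition completely_maxitive :: "'e topology \<Rightarrow> ('e set \<Rightarrow> 'l::order_bot) \<Rightarrow> bool" where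
  "completely_maxitive E \<nu> \<longleftrightarrow>
     \<nu> {} = bot \<and>
     (\<forall>\<F>. \<F> \<subseteq> borel_algebra E \<and> \<Union>\<F> \<in> borel_algebra E
        \<longrightarrow> isLub UNIV (\<nu> ` \<F>) (\<nu> (\<Union>\<F>)))"

definition open_values :: "'e topology \<Rightarrow> ('e set \<Rightarrow> 'l) \<Rightarrow> 'e set \<Rightarrow> 'l set" where
  "open_values E \<nu> B = {\<nu> G |G. openin E G \<and> B \<subseteq> G}"

text \<open>
  The infimum \<open>\<nu>\<^sup>+\<close>. The description operator is harmless: for a maxitive measure with values in
  a domain the infimum always exists, see \<open>isGlb_outer_value\<close> below.
\<close>

definition outer_value :: "'e topology \<Rightarrow> ('e set \<Rightarrow> 'l::order) \<Rightarrow> 'e set \<Rightarrow> 'l" where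
  "outer_value E \<nu> B = (THE i. isGlb UNIV (open_values E \<nu> B) i)"

definition weakly_inner_continuous :: "'e topology \<Rightarrow> ('e set \<Rightarrow> 'l::order) \<Rightarrow> bool" where
  "weakly_inner_continuous E \<nu> \<longleftrightarrow>
     (\<forall>G. openin E G \<longrightarrow>
        isLub UNIV {outer_value E \<nu> K |K. K \<in> compact_borel E \<and> K \<subseteq> G} (\<nu> G))"

definition weakly_outer_continuous :: "'e topology \<Rightarrow> ('e set \<Rightarrow> 'l::order) \<Rightarrow> bool" where
  "weakly_outer_continuous E \<nu> \<longleftrightarrow>
     (\<forall>K\<in>compact_borel E. isGlb UNIV (open_values E \<nu> K) (\<nu> K))"

definition regular_measure :: "'e topology \<Rightarrow> ('e set \<Rightarrow> 'l::order) \<Rightarrow> bool" where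
  "regular_measure E \<nu> \<longleftrightarrow>
     (\<forall>B\<in>borel_algebra E.
        isLub UNIV {\<nu> (saturation E K) |K. K \<in> compact_borel E \<and> K \<subseteq> B} (\<nu> B) \<and>
        isGlb UNIV (open_values E \<nu> B) (\<nu> B))"

section \<open>Well-definedness\<close>

lemma isGlb_UNIV_iff:
  "isGlb UNIV S (x::'l::order) \<longleftrightarrow> (\<forall>y\<in>S. x \<le> y) \<and> (\<forall>z. (\<forall>y\<in>S. z \<le> y) \<longrightarrow> z \<le> x)"
  by (auto simp: isGlb_def greatestP_def isLb_def setge_def setle_def)

lemma isLub_UNIV_iff:
  "isLub UNIV S (x::'l::order) \<longleftrightarrow> (\<forall>y\<in>S. y \<le> x) \<and> (\<forall>z. (\<forall>y\<in>S. y \<le> z) \<longrightarrow> x \<le> z)"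
  by (auto simp: isLub_def leastP_def isUb_def setge_def setle_def)

lemma outer_value_eq:
  assumes "isGlb UNIV (open_values E \<nu> B) (i::'l::order)"
  shows "outer_value E \<nu> B = i"
  unfolding outer_value_def
  using assms by (intro the_equality) (auto simp: isGlb_UNIV_iff intro: order.antisym)

lemma openin_borel_algebra: "openin E U \<Longrightarrow> U \<in> borel_algebra E"
  unfolding borel_algebra_def by (rule sigma_sets.Basic) simp

lemma maxitive_measure_mono:
  assumes m: "maxitive_measure E \<nu>" and A: "A \<in> borel_algebra E"
    and B: "B \<in> borel_algebra E" and "A \<subseteq> B"
  shows "\<nu> A \<le> \<nu> B"
proof -
  have "\<Union>{A, B} = B" using \<open>A \<subseteq> B\<close> by auto
  moreover have "finite {A, B} \<and> {A, B} \<subseteq> borel_algebra E \<and> \<Union>{A, B} \<in> borel_algebra E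
      \<longrightarrow> isLub UNIV (\<nu> ` {A, B}) (\<nu> (\<Union>{A, B}))"
    using m unfolding maxitive_measure_def by blast
  ultimately have "isLub UNIV (\<nu> ` {A, B}) (\<nu> B)" using A B by simp
  then show ?thesis by (simp add: isLub_UNIV_iff)
qed

lemma isGlb_outer_value:
  fixes \<nu> :: "'e set \<Rightarrow> 'l::order_bot"
  assumes dom: "is_domain TYPE('l)" and m: "maxitive_measure E \<nu>" and B: "B \<subseteq> topspace E"
  shows "isGlb UNIV (open_values E \<nu> B) (outer_value E \<nu> B)"
proof -
  define F where "F = {y. \<exists>v\<in>open_values E \<nu> B. v \<le> y}"
  have ne: "\<nu> (topspace E) \<in> F"
    using B by (auto simp: F_def open_values_def)
  have up: "\<forall>x\<in>F. \<forall>y. x \<le> y \<longrightarrow> y \<in> F"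
    unfolding F_def by (blast intro: order_trans)
  have dir: "\<exists>z\<in>F. z \<le> x \<and> z \<le> y" if "x \<in> F" "y \<in> F" for x y
  proof -
    obtain G H where G: "openin E G" "B \<subseteq> G" "\<nu> G \<le> x" and H: "openin E H" "B \<subseteq> H" "\<nu> H \<le> y"
      using \<open>x \<in> F\<close> \<open>y \<in> F\<close> by (auto simp: F_def open_values_def)
    have GH: "openin E (G \<inter> H)" "B \<subseteq> G \<inter> H" using G H by auto
    then have "\<nu> (G \<inter> H) \<in> F" by (auto simp: F_def open_values_def)
    moreover have "\<nu> (G \<inter> H) \<le> \<nu> G" "\<nu> (G \<inter> H) \<le> \<nu> H"
      using maxitive_measure_mono[OF m] openin_borel_algebra GH G H by auto
    ultimately show ?thesis using G(3) H(3) by (meson order_trans)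
  qed
  have "F \<noteq> {}" using ne by auto
  then have "poset_filter F" using up dir by (simp add: poset_filter_def)
  then obtain i where "isGlb UNIV F i" using dom by (auto simp: is_domain_def)
  moreover have "(\<forall>y\<in>F. z \<le> y) \<longleftrightarrow> (\<forall>y\<in>open_values E \<nu> B. z \<le> y)" for z
    unfolding F_def by (auto intro: order_trans)
  ultimately have i: "isGlb UNIV (open_values E \<nu> B) i" by (simp add: isGlb_UNIV_iff)
  then show ?thesis by (simp add: outer_value_eq[OF i])
qed

lemma saturation_compact_borel:
  assumes "compactin E K"
  shows "saturation E K \<in> compact_borel E"
proof -
  have sub: "K \<subseteq> saturation E K" and top: "saturation E K \<subseteq> topspace E"
    using assms by (auto simp: saturation_def compactin_def)
  have "compactin E (saturation E K)"
    unfolding compactin_def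
  proof (intro conjI allI impI)
    fix \<U> assume U: "(\<forall>U\<in>\<U>. openin E U) \<and> saturation E K \<subseteq> \<Union>\<U>"
    then obtain \<F> where F: "finite \<F>" "\<F> \<subseteq> \<U>" "K \<subseteq> \<Union>\<F>"
      using assms sub unfolding compactin_def by (meson order_trans)
    then have "openin E (\<Union>\<F>)" using U by blast
    then have "saturation E K \<subseteq> \<Union>\<F>" using F by (auto simp: saturation_def)
    then show "\<exists>\<F>. finite \<F> \<and> \<F> \<subseteq> \<U> \<and> saturation E K \<subseteq> \<Union>\<F>" using F by blast
  qed (rule top)
  moreover have "saturated_in E (saturation E K)"
    unfolding saturated_in_def
    using top by (intro exI[of _ "{U. openin E U \<and> K \<subseteq> U}"]) (auto simp: saturation_def)
  ultimately show ?thesis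
    by (auto simp: compact_borel_def borel_algebra_def)
qed

end

(* The proof rests on the density c(x) = \<nu>^+({x}). An upper bound u of c on a compact set K bounds
   \<nu>^+(K): for s \<ggreater> u every x in K has a neighbourhood of measure at most s, finitely many of them
   cover K, and the s \<ggreater> u have infimum u. Weak inner continuity then gives \<nu>(G) = sup {c(x) : x in G}
   for open G, and with this the covering argument no longer needs finiteness, so that
   \<nu>^+(B) = sup {c(x) : x in B} for every Borel set B. Finally \<nu>(B) = \<nu>^+(B), because the class of
   points topologically indistinguishable from x is a compact Borel set contained in every Borel
   set that contains x, and by weak outer continuity its measure is c(x). *)

theory Submission
  imports Defs
begin

section \<open>Approximation from above in domains\<close>

text \<open>By continuity \<open>r\<close> is the infimum of the elements way above it, so an
  estimate need only be proved with a margin \<open>s\<close>.\<close>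

lemma le_if_le_way_above:
  fixes r z :: "'l::order_bot"
  assumes dom: "is_domain TYPE('l)" and z: "\<And>s. way_above s r \<Longrightarrow> z \<le> s"
  shows "z \<le> r"
proof -
  have "isGlb UNIV {s. way_above s r} r"
    using dom by (simp add: is_domain_def continuous_poset_def)
  then show ?thesis using z by (simp add: isGlb_UNIV_iff)
qed

text \<open>The definition of \<open>way_above\<close> speaks of filters, while \<open>S\<close> is
  only down-directed. Its upward closure is a filter with the same lower bounds, hence the same
  infimum, so it contains \<open>s\<close>.\<close>

lemma ex_member_le_way_above:
  fixes r s :: "'l::order"
  assumes glb: "isGlb UNIV S i" and "i \<le> r" and "way_above s r"
    and "S \<noteq> {}" and dir: "\<And>x y. x \<in> S \<Longrightarrow> y \<in> S \<Longrightarrow> \<exists>z\<in>S. z \<le> x \<and> z \<le> y"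
  shows "\<exists>v\<in>S. v \<le> s"
proof -
  define F where "F = {y. \<exists>v\<in>S. v \<le> y}"
  have "poset_filter F"
    unfolding poset_filter_def
  proof (intro conjI ballI allI impI)
    show "F \<noteq> {}" using \<open>S \<noteq> {}\<close> by (auto simp: F_def)
    show "y \<in> F" if "x \<in> F" "x \<le> y" for x y
      using that unfolding F_def by (blast intro: order_trans)
    show "\<exists>z\<in>F. z \<le> x \<and> z \<le> y" if "x \<in> F" "y \<in> F" for x y
      using that dir unfolding F_def mem_Collect_eq Bex_def by (meson order_refl order_trans)
  qed
  moreover have "(\<forall>y\<in>F. z \<le> y) \<longleftrightarrow> (\<forall>y\<in>S. z \<le> y)" for z
    unfolding F_def by (auto intro: order_trans)
  then have "isGlb UNIV F i" using glb by (simp add: isGlb_UNIV_iff)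
  ultimately have "s \<in> F" using assms(2,3) unfolding way_above_def by blast
  then show ?thesis by (simp add: F_def)
qed

section \<open>The outer measure\<close>

lemma borel_algebra_subset_topspace: "B \<in> borel_algebra E \<Longrightarrow> B \<subseteq> topspace E"
  unfolding borel_algebra_def
  by (erule sigma_sets_into_sp[rotated]) (auto simp: saturated_in_def dest: openin_subset)

text \<open>Intersecting open supersets makes \<open>open_values\<close> down-directed, so the
  margin \<open>s\<close> is reached by an actual open set. Allowing any \<open>r\<close> above the
  outer value lets one \<open>s\<close> serve all points of a set whose densities have a common
  bound.\<close>

lemma ex_open_le_way_above:
  fixes \<nu> :: "'e set \<Rightarrow> 'l::order_bot"
  assumes dom: "is_domain TYPE('l)" and m: "maxitive_measure E \<nu>" and B: "B \<subseteq> topspace E"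
    and le: "outer_value E \<nu> B \<le> r" and s: "way_above s r"
  shows "\<exists>G. openin E G \<and> B \<subseteq> G \<and> \<nu> G \<le> s"
proof -
  have "\<exists>v\<in>open_values E \<nu> B. v \<le> s"
  proof (rule ex_member_le_way_above[OF isGlb_outer_value[OF dom m B] le s])
    show "open_values E \<nu> B \<noteq> {}" using B by (auto simp: open_values_def)
    fix x y assume "x \<in> open_values E \<nu> B" "y \<in> open_values E \<nu> B"
    then obtain G H where G: "openin E G" "B \<subseteq> G" "x = \<nu> G"
      and H: "openin E H" "B \<subseteq> H" "y = \<nu> H"
      by (auto simp: open_values_def)
    have "\<nu> (G \<inter> H) \<in> open_values E \<nu> B" using G H by (auto simp: open_values_def)
    moreover have "\<nu> (G \<inter> H) \<le> \<nu> G" "\<nu> (G \<inter> H) \<le> \<nu> H"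
      using G H by (auto intro!: maxitive_measure_mono[OF m] openin_borel_algebra)
    ultimately show "\<exists>z\<in>open_values E \<nu> B. z \<le> x \<and> z \<le> y" using G H by blast
  qed
  then show ?thesis by (auto simp: open_values_def)
qed

lemma outer_value_le:
  fixes \<nu> :: "'e set \<Rightarrow> 'l::order_bot"
  assumes "is_domain TYPE('l)" "maxitive_measure E \<nu>" "openin E G" "B \<subseteq> G"
  shows "outer_value E \<nu> B \<le> \<nu> G"
proof -
  have "B \<subseteq> topspace E" using assms(4) openin_subset[OF assms(3)] by (rule order_trans)
  from isGlb_outer_value[OF assms(1,2) this] assms(3,4) show ?thesis
    unfolding isGlb_UNIV_iff open_values_def by blast
qed

lemma outer_value_cong:
  assumes "\<And>U. openin E U \<Longrightarrow> A \<subseteq> U \<longleftrightarrow> B \<subseteq> U"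
  shows "outer_value E \<nu> A = outer_value E \<nu> B"
proof -
  have "open_values E \<nu> A = open_values E \<nu> B" using assms unfolding open_values_def by blast
  then show ?thesis by (simp add: outer_value_def)
qed

lemma outer_value_compact_le:
  fixes \<nu> :: "'e set \<Rightarrow> 'l::order_bot"
  assumes dom: "is_domain TYPE('l)" and m: "maxitive_measure E \<nu>" and K: "compactin E K"
    and u: "\<And>x. x \<in> K \<Longrightarrow> outer_value E \<nu> {x} \<le> u"
  shows "outer_value E \<nu> K \<le> u"
proof (rule le_if_le_way_above[OF dom])
  fix s assume s: "way_above s u"
  define \<U> where "\<U> = {G. openin E G \<and> \<nu> G \<le> s}"
  have "K \<subseteq> \<Union>\<U>"
  proof
    fix x assume x: "x \<in> K"
    then have "{x} \<subseteq> topspace E" using K by (auto simp: compactin_def)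
    from ex_open_le_way_above[OF dom m this u[OF x] s] show "x \<in> \<Union>\<U>"
      by (auto simp: \<U>_def)
  qed
  \<comment> \<open>Compactness enters here: maxitivity controls only finite unions.\<close>
  then obtain \<F> where F: "finite \<F>" "\<F> \<subseteq> \<U>" "K \<subseteq> \<Union>\<F>"
    using compactinD[OF K, of \<U>] by (auto simp: \<U>_def)
  have op: "openin E (\<Union>\<F>)" using F(2) by (auto simp: \<U>_def)
  have "\<F> \<subseteq> borel_algebra E" using F(2) by (auto simp: \<U>_def intro: openin_borel_algebra)
  then have "isLub UNIV (\<nu> ` \<F>) (\<nu> (\<Union>\<F>))"
    using m F(1) openin_borel_algebra[OF op] unfolding maxitive_measure_def by blast
  then have "\<nu> (\<Union>\<F>) \<le> s" using F(2) unfolding isLub_UNIV_iff \<U>_def by blast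
  with outer_value_le[OF dom m op F(3)] show "outer_value E \<nu> K \<le> s" by (rule order_trans)
qed

text \<open>Weak inner continuity passes the bound from compact subsets to \<open>G\<close>. This
  stands in for maxitivity over infinite families of open sets.\<close>

lemma open_measure_le:
  fixes \<nu> :: "'e set \<Rightarrow> 'l::order_bot"
  assumes dom: "is_domain TYPE('l)" and m: "maxitive_measure E \<nu>"
    and inner: "weakly_inner_continuous E \<nu>" and G: "openin E G"
    and u: "\<And>x. x \<in> G \<Longrightarrow> outer_value E \<nu> {x} \<le> u"
  shows "\<nu> G \<le> u"
proof -
  have "outer_value E \<nu> K \<le> u" if "K \<in> compact_borel E" "K \<subseteq> G" for K
    using that u by (auto simp: compact_borel_def intro!: outer_value_compact_le[OF dom m, of K])
  then have "\<forall>v\<in>{outer_value E \<nu> K |K. K \<in> compact_borel E \<and> K \<subseteq> G}. v \<le> u" by auto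
  moreover have "isLub UNIV {outer_value E \<nu> K |K. K \<in> compact_borel E \<and> K \<subseteq> G} (\<nu> G)"
    using inner G by (simp add: weakly_inner_continuous_def)
  ultimately show ?thesis unfolding isLub_UNIV_iff by simp
qed

lemma outer_value_le_density_bound:
  fixes \<nu> :: "'e set \<Rightarrow> 'l::order_bot"
  assumes dom: "is_domain TYPE('l)" and m: "maxitive_measure E \<nu>"
    and inner: "weakly_inner_continuous E \<nu>" and B: "B \<subseteq> topspace E"
    and u: "\<And>x. x \<in> B \<Longrightarrow> outer_value E \<nu> {x} \<le> u"
  shows "outer_value E \<nu> B \<le> u"
proof (rule le_if_le_way_above[OF dom])
  fix s assume s: "way_above s u"
  define \<U> where "\<U> = {G. openin E G \<and> \<nu> G \<le> s}"
  have "B \<subseteq> \<Union>\<U>"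
  proof
    fix x assume x: "x \<in> B"
    then have "{x} \<subseteq> topspace E" using B by auto
    from ex_open_le_way_above[OF dom m this u[OF x] s] show "x \<in> \<Union>\<U>"
      by (auto simp: \<U>_def)
  qed
  moreover have op: "openin E (\<Union>\<U>)" by (auto simp: \<U>_def)
  ultimately have "outer_value E \<nu> B \<le> \<nu> (\<Union>\<U>)" by (intro outer_value_le[OF dom m])
  \<comment> \<open>The family may be infinite, but each point of the union lies in a member of
    measure at most \<open>s\<close>, so the density is bounded by \<open>s\<close> on the whole
    union.\<close>
  also have "\<nu> (\<Union>\<U>) \<le> s"
  proof (rule open_measure_le[OF dom m inner op])
    fix y assume "y \<in> \<Union>\<U>"
    then obtain G where "openin E G" "y \<in> G" "\<nu> G \<le> s" by (auto simp: \<U>_def)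
    then show "outer_value E \<nu> {y} \<le> s"
      using order_trans[OF outer_value_le[OF dom m, of G "{y}"]] by simp
  qed
  finally show "outer_value E \<nu> B \<le> s" .
qed

section \<open>Topologically indistinguishable points\<close>

text \<open>Without T0 separation a singleton need not be Borel; this class replaces it as the
  smallest Borel set containing \<open>x\<close>.\<close>

definition indistinguishable_class :: "'e topology \<Rightarrow> 'e \<Rightarrow> 'e set" where
  "indistinguishable_class E x =
     {y \<in> topspace E. \<forall>U. openin E U \<longrightarrow> (x \<in> U \<longleftrightarrow> y \<in> U)}"

lemma mem_indistinguishable_class: "x \<in> topspace E \<Longrightarrow> x \<in> indistinguishable_class E x"
  by (simp add: indistinguishable_class_def)

lemma indistinguishable_class_subset_open_iff:
  assumes "x \<in> topspace E" "openin E U"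
  shows "indistinguishable_class E x \<subseteq> U \<longleftrightarrow> x \<in> U"
  using assms by (auto simp: indistinguishable_class_def)

text \<open>Open sets do not separate \<open>x\<close> from \<open>y\<close>, hence neither do their
  intersections, and not separating two points of the space survives complements and countable
  unions.\<close>

lemma borel_algebra_indistinguishable:
  assumes "B \<in> borel_algebra E" and y: "y \<in> indistinguishable_class E x" and x: "x \<in> topspace E"
  shows "x \<in> B \<longleftrightarrow> y \<in> B"
  using assms(1) unfolding borel_algebra_def
proof (induction rule: sigma_sets.induct)
  case (Basic A)
  have U: "x \<in> U \<longleftrightarrow> y \<in> U" if "openin E U" for U
    using y that by (simp add: indistinguishable_class_def)
  have "y \<in> topspace E" using y by (simp add: indistinguishable_class_def)
  from Basic show ?case
  proof
    assume "A \<in> {K. compactin E K \<and> saturated_in E K}"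
    then obtain \<U> where "\<forall>U\<in>\<U>. openin E U" "A = topspace E \<inter> \<Inter>\<U>"
      by (auto simp: saturated_in_def)
    with U x \<open>y \<in> topspace E\<close> show ?thesis by auto
  qed (use U in simp)
next
  case (Compl A)
  then show ?case using x y by (auto simp: indistinguishable_class_def)
qed auto

lemma indistinguishable_class_subset_borel:
  assumes "B \<in> borel_algebra E" "x \<in> B"
  shows "indistinguishable_class E x \<subseteq> B"
  using borel_algebra_indistinguishable[OF assms(1)] borel_algebra_subset_topspace[OF assms(1)]
    assms(2) by blast

text \<open>The closure collects the points all of whose neighbourhoods contain \<open>x\<close>,
  the saturation those lying in all neighbourhoods of \<open>x\<close>. As a closed set meeting a
  compact saturated one, the class is compact and Borel.\<close>

lemma indistinguishable_class_eq:
  assumes "x \<in> topspace E"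
  shows "indistinguishable_class E x = (E closure_of {x}) \<inter> saturation E {x}"
  using assms by (auto simp: indistinguishable_class_def saturation_def closure_of_def)

lemma indistinguishable_class_compact_borel:
  assumes x: "x \<in> topspace E"
  shows "indistinguishable_class E x \<in> compact_borel E"
proof -
  have "compactin E {x}" using x by simp
  then have S: "saturation E {x} \<in> borel_algebra E" and comp: "compactin E (saturation E {x})"
    using saturation_compact_borel[of E "{x}"] by (simp_all add: compact_borel_def)
  interpret sigma_algebra "topspace E" "borel_algebra E"
    unfolding borel_algebra_def
    by (rule sigma_algebra_sigma_sets) (auto simp: saturated_in_def dest: openin_subset)
  have "topspace E - (topspace E - E closure_of {x}) \<in> borel_algebra E"
    by (intro compl_sets openin_borel_algebra openin_diff openin_topspace closedin_closure_of)
  then have "E closure_of {x} \<in> borel_algebra E"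
    by (simp add: double_diff closure_of_subset_topspace)
  then have "indistinguishable_class E x \<in> borel_algebra E"
    using S unfolding indistinguishable_class_eq[OF x] by blast
  moreover have "compactin E (indistinguishable_class E x)"
    unfolding indistinguishable_class_eq[OF x]
    by (rule closed_Int_compactin[OF closedin_closure_of comp])
  ultimately show ?thesis by (simp add: compact_borel_def)
qed

section \<open>Regularity and complete maxitivity\<close>

text \<open>Weak outer continuity applies to the class, and the class has the same open supersets as
  \<open>{x}\<close>.\<close>

lemma outer_value_singleton_eq:
  fixes \<nu> :: "'e set \<Rightarrow> 'l::order_bot"
  assumes outer: "weakly_outer_continuous E \<nu>" and x: "x \<in> topspace E"
  shows "\<nu> (indistinguishable_class E x) = outer_value E \<nu> {x}"
proof -
  have "outer_value E \<nu> (indistinguishable_class E x) = \<nu> (indistinguishable_class E x)"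
    using outer indistinguishable_class_compact_borel[OF x]
    by (intro outer_value_eq) (auto simp: weakly_outer_continuous_def)
  moreover have "outer_value E \<nu> (indistinguishable_class E x) = outer_value E \<nu> {x}"
    by (rule outer_value_cong) (simp add: indistinguishable_class_subset_open_iff[OF x])
  ultimately show ?thesis by simp
qed

theorem proposition3p11:
  fixes E :: "'e topology" and \<nu> :: "'e set \<Rightarrow> 'l::order_bot"
  assumes "is_domain TYPE('l)"
    and "maxitive_measure E \<nu>"
    and "weakly_outer_continuous E \<nu>"
    and "weakly_inner_continuous E \<nu>"
  shows "regular_measure E \<nu> \<and> completely_maxitive E \<nu>"
proof -
  note dom = assms(1) and m = assms(2) and outer = assms(3) and inner = assms(4)
  have mono: "\<nu> A \<le> \<nu> B" if "A \<in> borel_algebra E" "B \<in> borel_algebra E" "A \<subseteq> B" for A B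
    using maxitive_measure_mono[OF m] that by blast
  have density_le: "outer_value E \<nu> {x} \<le> \<nu> B" if B: "B \<in> borel_algebra E" and "x \<in> B" for x B
  proof -
    have x: "x \<in> topspace E" using that borel_algebra_subset_topspace by blast
    have "\<nu> (indistinguishable_class E x) \<le> \<nu> B"
      using indistinguishable_class_compact_borel[OF x] that
      by (intro mono indistinguishable_class_subset_borel) (auto simp: compact_borel_def)
    then show ?thesis by (simp add: outer_value_singleton_eq[OF outer x])
  qed
  have outer_value_le_bound: "outer_value E \<nu> B \<le> u"
    if "B \<in> borel_algebra E" "\<And>x. x \<in> B \<Longrightarrow> outer_value E \<nu> {x} \<le> u" for B u
    using outer_value_le_density_bound[OF dom m inner borel_algebra_subset_topspace] that by blast
  \<comment> \<open>Monotonicity makes \<nu>(B) a lower bound. It is the greatest because it bounds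
    the density on \<open>B\<close>, and therefore bounds the outer value.\<close>
  have glb: "isGlb UNIV (open_values E \<nu> B) (\<nu> B)" if B: "B \<in> borel_algebra E" for B
  proof -
    have o: "isGlb UNIV (open_values E \<nu> B) (outer_value E \<nu> B)"
      by (rule isGlb_outer_value[OF dom m borel_algebra_subset_topspace[OF B]])
    have "outer_value E \<nu> B \<le> \<nu> B" using outer_value_le_bound[OF B] density_le[OF B] by blast
    then have "\<forall>z. (\<forall>v\<in>open_values E \<nu> B. z \<le> v) \<longrightarrow> z \<le> \<nu> B"
      using o by (auto simp: isGlb_UNIV_iff intro: order_trans)
    moreover have "\<nu> B \<le> v" if "v \<in> open_values E \<nu> B" for v
      using that mono[OF B] openin_borel_algebra by (auto simp: open_values_def)
    ultimately show ?thesis by (simp add: isGlb_UNIV_iff)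
  qed
  \<comment> \<open>Together with \<open>density_le\<close> this makes \<nu>(B) the supremum of the
    density over \<open>B\<close>, so both remaining claims reduce to single points.\<close>
  have measure_le_bound: "\<nu> B \<le> u"
    if "B \<in> borel_algebra E" "\<And>x. x \<in> B \<Longrightarrow> outer_value E \<nu> {x} \<le> u" for B u
    using outer_value_le_bound[OF that] outer_value_eq[OF glb[OF that(1)]] by simp
  have "regular_measure E \<nu>"
    unfolding regular_measure_def
  proof (intro ballI conjI glb)
    fix B assume B: "B \<in> borel_algebra E"
    show "isLub UNIV {\<nu> (saturation E K) |K. K \<in> compact_borel E \<and> K \<subseteq> B} (\<nu> B)"
      unfolding isLub_UNIV_iff
    proof (intro conjI ballI allI impI)
      fix v assume "v \<in> {\<nu> (saturation E K) |K. K \<in> compact_borel E \<and> K \<subseteq> B}"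
      then obtain K where K: "compactin E K" "K \<in> borel_algebra E" "K \<subseteq> B"
        and v: "v = \<nu> (saturation E K)" by (auto simp: compact_borel_def)
      have S: "saturation E K \<in> borel_algebra E"
        using saturation_compact_borel[OF K(1)] by (simp add: compact_borel_def)
      \<comment> \<open>A set and its saturation have the same open supersets; by \<open>glb\<close>
        they then have equal measure.\<close>
      have "outer_value E \<nu> (saturation E K) = outer_value E \<nu> K"
        by (rule outer_value_cong) (auto simp: saturation_def)
      then have "v = \<nu> K"
        using outer_value_eq[OF glb[OF S]] outer_value_eq[OF glb[OF K(2)]] v by simp
      then show "v \<le> \<nu> B" using mono K B by simp
    next
      fix u assume u: "\<forall>v\<in>{\<nu> (saturation E K) |K. K \<in> compact_borel E \<and> K \<subseteq> B}. v \<le> u"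
      show "\<nu> B \<le> u"
      proof (rule measure_le_bound[OF B])
        fix x assume "x \<in> B"
        then have x: "x \<in> topspace E" using borel_algebra_subset_topspace[OF B] by blast
        \<comment> \<open>The class serves as the compact Borel subset of \<open>B\<close>
          witnessing the density at \<open>x\<close>.\<close>
        let ?K = "indistinguishable_class E x"
        have K: "?K \<in> compact_borel E" by (rule indistinguishable_class_compact_borel[OF x])
        then have S: "saturation E ?K \<in> borel_algebra E"
          using saturation_compact_borel[of E ?K] by (auto simp: compact_borel_def)
        have "x \<in> saturation E ?K"
          using mem_indistinguishable_class[OF x] by (auto simp: saturation_def)
        then have "outer_value E \<nu> {x} \<le> \<nu> (saturation E ?K)" by (rule density_le[OF S])
        also have "\<dots> \<le> u"
          using u K indistinguishable_class_subset_borel[OF B \<open>x \<in> B\<close>] by blast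
        finally show "outer_value E \<nu> {x} \<le> u" .
      qed
    qed
  qed
  moreover have "completely_maxitive E \<nu>"
    unfolding completely_maxitive_def
  proof (intro conjI allI impI)
    show "\<nu> {} = bot" using m by (simp add: maxitive_measure_def)
    fix \<F> assume F: "\<F> \<subseteq> borel_algebra E \<and> \<Union>\<F> \<in> borel_algebra E"
    show "isLub UNIV (\<nu> ` \<F>) (\<nu> (\<Union>\<F>))"
      unfolding isLub_UNIV_iff
    proof (intro conjI ballI allI impI)
      fix v assume "v \<in> \<nu> ` \<F>"
      then show "v \<le> \<nu> (\<Union>\<F>)" using F mono by blast
    next
      fix u assume u: "\<forall>v\<in>\<nu> ` \<F>. v \<le> u"
      show "\<nu> (\<Union>\<F>) \<le> u"
      proof (rule measure_le_bound)
        show "\<Union>\<F> \<in> borel_algebra E" using F ..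
        fix x assume "x \<in> \<Union>\<F>"
        then obtain B where "B \<in> \<F>" "x \<in> B" ..
        then have "outer_value E \<nu> {x} \<le> \<nu> B" using F by (intro density_le) auto
        also have "\<dots> \<le> u" using u \<open>B \<in> \<F>\<close> by simp
        finally show "outer_value E \<nu> {x} \<le> u" .
      qed
    qed
  qed
  ultimately show ?thesis ..
qed

end
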